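(* Let $n,k$ be integers with $1\le k\le n-1$, let $q$ be a prime power, and let $\mathcal{A}$ be a $k\times n$ matrix over the finite field $\mathbb{F}_q$ that is a generator matrix of a linear maximum distance separable (MDS) code $C\subseteq\mathbb{F}_q^n$ of dimension $k$. Let $X=(X_1,\dots,X_n)$ be uniformly distributed on the $q^k$ codewords of $C$, i.e. on the row space of $\mathcal{A}$. Then $X$ attains the maximum value of Cohesion-$k$: $$\mathcal{C}^{(k)}(X)=k\binom{n-1}{k}.$$
   Context: Shannon entropy is taken with logarithms to base $q$: $H(Y)=\sum_y p(y)\log_q(1/p(y))$. For $A\subseteq\{1,\dots,n\}$ write $X_A=(X_i)_{i\in A}$. For $1\le k\le n-1$, the Cohesion-$k$ measure is $$\mathcal{C}^{(k)}(X)=\sum_{A\subseteq\{1,\dots,n\},\,|A|=k}H(X_A)-\binom{n-1}{k-1}H(X).$$ A linear code $C\subseteq\mathbb{F}_q^n$ of dimension $k$ with minimum Hamming distance $d$ (between distinct codewords) is maximum distance separable (MDS) if $d=n-k+1$. A generator matrix of $C$ is a $k\times n$ matrix whose rows form a basis of $C$. *)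

theory Defs
  imports "HOL-Probability.Probability"
begin

section \<open>Discrete Shannon entropy and Cohesion\<close>

text \<open>
  The library's entropy is defined through the Kullback--Leibler divergence from the counting
  measure; the lemma below is the usual formula for random variables with finitely many values.
\<close>

definition shannon_entropy :: "real \<Rightarrow> 'w measure \<Rightarrow> ('w \<Rightarrow> 'b) \<Rightarrow> real" where
  "shannon_entropy q M Y = prob_space.entropy M q (count_space (Y ` space M)) Y"

lemma shannon_entropy_eq:
  fixes Y :: "'w \<Rightarrow> 'b"
  assumes "prob_space M" "1 < q" "Y \<in> measurable M (count_space UNIV)" "finite (Y ` space M)"
  shows "shannon_entropy q M Y =
    (\<Sum>y\<in>Y ` space M. measure M {\<omega> \<in> space M. Y \<omega> = y}
                        * log q (1 / measure M {\<omega> \<in> space M. Y \<omega> = y}))"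
proof -
  interpret information_space M q
    using assms(1,2) by (simp add: information_space_def information_space_axioms_def)
  have "Y -` {y} \<inter> space M \<in> sets M" for y
    using assms(3) by (rule measurable_sets) simp
  then have "simple_function M Y"
    using assms(4) by (simp add: simple_function_def)
  then have "simple_distributed M Y (\<lambda>y. measure M (Y -` {y} \<inter> space M))"
    by (rule simple_distributedI) auto
  then have "shannon_entropy q M Y =
      - (\<Sum>y\<in>Y ` space M. measure M (Y -` {y} \<inter> space M) * log q (measure M (Y -` {y} \<inter> space M)))"
    unfolding shannon_entropy_def by (rule entropy_simple_distributed)
  moreover have "Y -` {y} \<inter> space M = {\<omega> \<in> space M. Y \<omega> = y}" for y
    by auto
  ultimately show ?thesis
    by (simp add: log_divide_pos log_recip flip: sum_negf)
qed

text \<open>The subvector $X_A$, encoded as a function that is undefined outside \<open>A\<close>.\<close>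

definition subvector :: "'n set \<Rightarrow> ('w \<Rightarrow> 'a ^ 'n) \<Rightarrow> 'w \<Rightarrow> 'n \<Rightarrow> 'a" where
  "subvector A X \<omega> = restrict (\<lambda>i. X \<omega> $ i) A"

definition cohesion :: "real \<Rightarrow> nat \<Rightarrow> 'w measure \<Rightarrow> ('w \<Rightarrow> 'a ^ 'n::finite) \<Rightarrow> real" where
  "cohesion q k M X =
     (\<Sum>A | A \<subseteq> (UNIV :: 'n set) \<and> card A = k. shannon_entropy q M (subvector A X))
     - real ((CARD('n) - 1) choose (k - 1)) * shannon_entropy q M X"


section \<open>Linear codes\<close>

definition hamming_dist :: "'a ^ 'n::finite \<Rightarrow> 'a ^ 'n \<Rightarrow> nat" where
  "hamming_dist x y = card {i. x $ i \<noteq> y $ i}"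

text \<open>Only meaningful for codes with at least two codewords.\<close>

definition min_distance :: "('a::finite ^ 'n::finite) set \<Rightarrow> nat" where
  "min_distance C = Min {hamming_dist x y | x y. x \<in> C \<and> y \<in> C \<and> x \<noteq> y}"

definition MDS_code :: "nat \<Rightarrow> ('a::{field,finite} ^ 'n::finite) set \<Rightarrow> bool" where
  "MDS_code k C \<longleftrightarrow>
     vec.subspace C \<and> vec.dim C = k \<and> min_distance C = CARD('n) - k + 1"

text \<open>
  Injectivity makes the rows independent as a family: \<open>rows G\<close> is a set and forgets repetitions.
\<close>

definition generator_matrix :: "'a::field ^ 'n::finite ^ 'k::finite \<Rightarrow> ('a ^ 'n) set \<Rightarrow> bool" where
  "generator_matrix G C \<longleftrightarrow>
     inj (\<lambda>i. row i G) \<and> vec.independent (rows G) \<and> vec.span (rows G) = C"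

end

theory Submission
  imports Defs
begin

text \<open>
  Any two codewords of an MDS code that agree on \<open>k\<close> coordinates are equal, so $X$ and every
  $X_A$ with $|A| = k$ are uniform on $q^k$ values and have entropy \<open>k\<close>. For an arbitrary $Y$ with
  entropy $h$, each $H(Y_A)$ is at most $\min(k, h)$, and
  $\binom{n}{k}\min(k, h) - \binom{n-1}{k-1} h \le \binom{n-1}{k}\min(k, h)$.
\<close>

lemma simple_function_count_space_finite:
  fixes Y :: "'w \<Rightarrow> 'b::finite"
  assumes "Y \<in> measurable M (count_space UNIV)"
  shows "simple_function M (f \<circ> Y)"
proof -
  have "simple_function M Y"
    using measurable_sets[OF assms] by (auto simp: simple_function_def)
  then show ?thesis
    by (rule simple_function_compose)
qed

text \<open>This is the data processing inequality. With restriction to \<open>A\<close> as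
  \<open>f\<close>, it bounds the entropy of a subvector by that of the whole vector.\<close>

lemma shannon_entropy_compose_le:
  fixes Y :: "'w \<Rightarrow> 'b::finite"
  assumes "prob_space M" "1 < q" "Y \<in> measurable M (count_space UNIV)"
  shows "shannon_entropy q M (f \<circ> Y) \<le> shannon_entropy q M Y"
proof -
  interpret information_space M q
    using assms by (simp add: information_space_def information_space_axioms_def)
  show ?thesis
    unfolding shannon_entropy_def
    using entropy_data_processing simple_function_count_space_finite[OF assms(3), of id] by simp
qed

text \<open>Entropy is largest for the uniform law on the attained values. Passing to a larger set
  \<open>S\<close> allows a bound whose cardinality is easy to count.\<close>

lemma shannon_entropy_le_log_card:
  fixes Y :: "'w \<Rightarrow> 'b::finite"
  assumes "prob_space M" "1 < q" "Y \<in> measurable M (count_space UNIV)"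
    and "finite S" "range f \<subseteq> S"
  shows "shannon_entropy q M (f \<circ> Y) \<le> log q (real (card S))"
proof -
  interpret information_space M q
    using assms by (simp add: information_space_def information_space_axioms_def)
  have "(f \<circ> Y) ` space M \<subseteq> S"
    using assms(5) by auto
  then have "card ((f \<circ> Y) ` space M) \<le> card S"
    using assms(4) card_mono by blast
  \<comment> \<open>The logarithm is monotone only on positive arguments; a probability space is
    nonempty, so some value is attained.\<close>
  moreover have "0 < card ((f \<circ> Y) ` space M)"
    using not_empty finite_subset[OF \<open>(f \<circ> Y) ` space M \<subseteq> S\<close> assms(4)]
    by (simp only: card_gt_0_iff image_is_empty) simp
  ultimately have "log q (card ((f \<circ> Y) ` space M)) \<le> log q (card S)"
    using assms(2) by simp
  then show ?thesis
    unfolding shannon_entropy_def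
    using entropy_le_card[OF simple_distributedI[OF simple_function_count_space_finite[OF assms(3), of f]
        measure_nonneg refl]] by linarith
qed

text \<open>A map injective on \<open>C\<close> carries the uniform law on \<open>C\<close> to the
  uniform law on an image of the same size. Taking it to be a projection or \<open>id\<close> covers
  subvectors and the whole vector at once.\<close>

lemma shannon_entropy_uniform_inj:
  fixes X :: "'w \<Rightarrow> 'b::finite"
  assumes M: "prob_space M" and q: "1 < q" and X: "X \<in> measurable M (count_space UNIV)"
    and distr: "distr M (count_space UNIV) X = uniform_measure (count_space UNIV) C"
    and C: "C \<noteq> {}" and inj: "inj_on f C"
  shows "shannon_entropy q M (f \<circ> X) = log q (real (card C))"
proof -
  interpret prob_space M by fact
  have prob: "measure M {\<omega> \<in> space M. X \<omega> \<in> T} = real (card (C \<inter> T)) / real (card C)" for T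
  proof -
    have "measure M {\<omega> \<in> space M. X \<omega> \<in> T} = measure (distr M (count_space UNIV) X) T"
      using X by (subst measure_distr) (auto intro!: arg_cong[where f = "measure M"])
    also have "\<dots> = measure (uniform_measure (count_space UNIV) C) T"
      by (simp only: distr)
    also have "\<dots> = real (card (C \<inter> T)) / real (card C)"
      using C by (subst measure_uniform_measure)
        (auto simp: emeasure_count_space measure_count_space card_gt_0_iff)
    finally show ?thesis .
  qed
  \<comment> \<open>By injectivity each fibre of \<open>f\<close> meets \<open>C\<close> in at most
    one point.\<close>
  have p: "measure M {\<omega> \<in> space M. (f \<circ> X) \<omega> = y} = (if y \<in> f ` C then 1 / real (card C) else 0)" for y
  proof (cases "y \<in> f ` C")
    case True
    then obtain c where "c \<in> C" "y = f c" by blast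
    then have "C \<inter> {x. f x = y} = {c}"
      using inj by (auto dest: inj_onD)
    then show ?thesis
      using prob[of "{x. f x = y}"] True by simp
  next
    case False
    then have "C \<inter> {x. f x = y} = {}" by auto
    then show ?thesis
      using prob[of "{x. f x = y}"] False by simp
  qed
  \<comment> \<open>Values of positive probability are attained. Equality can fail, since
    \<open>X\<close> may leave \<open>C\<close> on a null set.\<close>
  have sub: "f ` C \<subseteq> (f \<circ> X) ` space M"
  proof
    fix y assume "y \<in> f ` C"
    then have "measure M {\<omega> \<in> space M. (f \<circ> X) \<omega> = y} \<noteq> 0"
      using p[of y] C by simp
    then have "{\<omega> \<in> space M. (f \<circ> X) \<omega> = y} \<noteq> {}"
      by (metis measure_empty)
    then show "y \<in> (f \<circ> X) ` space M" by auto
  qed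
  have fin: "finite ((f \<circ> X) ` space M)"
    by (metis finite image_comp finite_imageI)
  have "shannon_entropy q M (f \<circ> X) = (\<Sum>y\<in>(f \<circ> X) ` space M.
      (if y \<in> f ` C then 1 / real (card C) else 0)
        * log q (1 / (if y \<in> f ` C then 1 / real (card C) else 0)))"
    using shannon_entropy_eq[OF M q _ fin] X p by (simp add: measurable_compose_rev[of f])
  \<comment> \<open>Values outside the image of \<open>C\<close> have probability 0, and this factor
    makes their terms vanish.\<close>
  also have "\<dots> = (\<Sum>y\<in>f ` C. 1 / real (card C) * log q (real (card C)))"
    using sub fin by (intro sum.mono_neutral_cong_right) auto
  also have "\<dots> = log q (real (card C))"
    using C by (simp add: card_image[OF inj])
  finally show ?thesis .
qed

lemma card_subspace:
  fixes C :: "('a::{field,finite} ^ 'n::finite) set"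
  assumes "vec.subspace C" "vec.dim C = CARD('k::finite)"
  shows "card C = CARD('a) ^ CARD('k)"
proof -
  \<comment> \<open>Spaces of equal dimension are isomorphic, so \<open>C\<close> can be counted
    through the full space of vectors indexed by \<open>'k\<close>.\<close>
  have "\<exists>f. Vector_Spaces.linear (*s) (*s) f \<and> f ` (UNIV :: ('a ^ 'k) set) = C
      \<and> inj_on f (UNIV :: ('a ^ 'k) set)"
    using vec.subspace_isomorphism[of "UNIV :: ('a ^ 'k) set" C] assms
    by (metis vec.dim_UNIV vec.subspace_UNIV vec.dimension_def vec_dim_card)
  then have "card C = CARD('a ^ 'k)"
    by (metis card_image)
  then show ?thesis by simp
qed

text \<open>Agreement on \<open>k\<close> coordinates leaves at most \<open>n - k\<close> places to
  differ, one fewer than the minimum distance.\<close>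

lemma MDS_code_agree_imp_eq:
  fixes C :: "('a::{field,finite} ^ 'n::finite) set"
  assumes "MDS_code k C" "x \<in> C" "y \<in> C" "card A = k" "\<forall>i\<in>A. x $ i = y $ i"
  shows "x = y"
proof (rule ccontr)
  assume "x \<noteq> y"
  have "min_distance C \<le> hamming_dist x y"
    unfolding min_distance_def using assms(2,3) \<open>x \<noteq> y\<close>
    by (intro Min_le finite_subset[OF _ finite_imageI[of UNIV "case_prod hamming_dist"]])
      (auto simp: image_iff)
  moreover have "hamming_dist x y \<le> card (- A)"
    unfolding hamming_dist_def using assms(5) by (intro card_mono) auto
  moreover have "card (- A) = CARD('n) - k"
    using card_Diff_subset[of A UNIV] assms(4) by (simp add: Compl_eq_Diff_UNIV)
  ultimately show False
    using assms(1) by (simp add: MDS_code_def)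
qed

lemma subvector_eq_compose: "subvector A X = (\<lambda>x. restrict (\<lambda>i. x $ i) A) \<circ> X"
  by (auto simp: subvector_def)

text \<open>Pascal's rule. Both lower bounds matter: with truncated subtraction it fails for
  \<open>k = 0\<close>, and for \<open>n = 0\<close> with \<open>k = 1\<close>.\<close>

lemma real_binomial_pred:
  assumes "1 \<le> k" "1 \<le> n"
  shows "real (n choose k) = real ((n - 1) choose (k - 1)) + real ((n - 1) choose k)"
  using assms by (cases n; cases k) auto

lemma card_subsets_card: "card {A. A \<subseteq> (UNIV :: 'n::finite set) \<and> card A = k} = CARD('n) choose k"
  by (rule n_subsets) simp

lemma cohesion_le:
  fixes Y :: "'v \<Rightarrow> 'a::finite ^ 'n::finite"
  assumes N: "prob_space N" and Y: "Y \<in> measurable N (count_space UNIV)"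
    and q: "q = real CARD('a)" "1 < q" and k: "1 \<le> k"
  shows "cohesion q k N Y \<le> real (k * ((CARD('n) - 1) choose k))"
proof -
  let ?h = "shannon_entropy q N Y" and ?m = "min (real k) (shannon_entropy q N Y)"
  let ?S = "{A. A \<subseteq> (UNIV :: 'n set) \<and> card A = k}"
  have "shannon_entropy q N (subvector A Y) \<le> ?m" if "card A = k" for A
  proof -
    \<comment> \<open>Restrictions to \<open>A\<close> are extensional functions on
      \<open>A\<close>, of which there are \<open>q ^ k\<close>; the logarithm to base
      \<open>q\<close> turns this into \<open>k\<close>.\<close>
    have "shannon_entropy q N (subvector A Y) \<le> log q (card (PiE A (\<lambda>_. UNIV :: 'a set)))"
      unfolding subvector_eq_compose
      by (rule shannon_entropy_le_log_card[OF N q(2) Y]) (auto intro: finite_PiE)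
    also have "\<dots> = real k"
      using q that by (simp add: card_PiE log_nat_power)
    finally show ?thesis
      using shannon_entropy_compose_le[OF N q(2) Y] by (simp add: subvector_eq_compose)
  qed
  then have "(\<Sum>A\<in>?S. shannon_entropy q N (subvector A Y)) \<le> (\<Sum>A\<in>?S. ?m)"
    by (intro sum_mono) simp
  also have "\<dots> = real (CARD('n) choose k) * ?m"
    using card_subsets_card[where 'n = 'n, of k] by simp
  also have "\<dots> = real ((CARD('n) - 1) choose (k - 1)) * ?m + real ((CARD('n) - 1) choose k) * ?m"
    using k by (simp add: real_binomial_pred[of k "CARD('n)"] distrib_right Suc_leI)
  \<comment> \<open>The minimum is bounded by a different argument in each summand: by
    \<open>?h\<close> in the first, which then cancels the term subtracted in
    \<open>cohesion\<close>, and by \<open>k\<close> in the second.\<close>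
  also have "\<dots> \<le> real ((CARD('n) - 1) choose (k - 1)) * ?h + real ((CARD('n) - 1) choose k) * real k"
    by (intro add_mono mult_left_mono) auto
  finally show ?thesis
    by (simp add: cohesion_def mult.commute)
qed

theorem mainTheorem4:
  fixes n k :: nat
    and q :: real
    and G :: "'a::{field,finite} ^ 'n::finite ^ 'k::finite"
    and C :: "('a ^ 'n) set"
    and M :: "'w measure"
    and X :: "'w \<Rightarrow> 'a ^ 'n"
  assumes "n = CARD('n)" and "k = CARD('k)" and "q = real CARD('a)"
    and "1 \<le> k" and "k \<le> n - 1"
    and "MDS_code k C"
    and "generator_matrix G C"
    and "prob_space M"
    and "X \<in> measurable M (count_space UNIV)"
    and "distr M (count_space UNIV) X = uniform_measure (count_space UNIV) C"
  shows "cohesion q k M X = real (k * ((n - 1) choose k)) \<and>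
    (\<forall>(N :: 'v measure) (Y :: 'v \<Rightarrow> 'a ^ 'n).
       prob_space N \<longrightarrow> Y \<in> measurable N (count_space UNIV) \<longrightarrow>
       cohesion q k N Y \<le> cohesion q k M X)"
proof -
  \<comment> \<open>A field contains the two distinct elements 0 and 1.\<close>
  have q: "1 < q"
    using assms(3) card_mono[of "UNIV :: 'a set" "{0, 1}"] by simp
  have "card C = CARD('a) ^ k"
    using assms card_subspace[of C, where 'k = 'k] by (simp add: MDS_code_def)
  then have logC: "log q (real (card C)) = real k" and "C \<noteq> {}"
    using q assms(3) by (auto simp: log_nat_power)
  \<comment> \<open>Every function injective on \<open>C\<close> now yields entropy
    \<open>k\<close>.\<close>
  note uniform = shannon_entropy_uniform_inj[OF assms(8) q assms(9,10) \<open>C \<noteq> {}\<close>, unfolded logC]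
  have "shannon_entropy q M (subvector A X) = real k" if "card A = k" for A
  proof -
    have "inj_on (\<lambda>x. restrict (\<lambda>i. x $ i) A) C"
    proof (rule inj_onI)
      fix x y assume "x \<in> C" "y \<in> C" and eq: "restrict (\<lambda>i. x $ i) A = restrict (\<lambda>i. y $ i) A"
      moreover have "\<forall>i\<in>A. x $ i = y $ i"
        using eq by (metis restrict_apply')
      ultimately show "x = y"
        using MDS_code_agree_imp_eq[OF assms(6)] that by blast
    qed
    then show ?thesis
      unfolding subvector_eq_compose by (rule uniform)
  qed
  moreover have "shannon_entropy q M X = real k"
    using uniform[of id] by simp
  ultimately have "cohesion q k M X = real k * real (n choose k) - real k * real ((n - 1) choose (k - 1))"
    using card_subsets_card[where 'n = 'n, of k] assms(1) by (simp add: cohesion_def mult.commute)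
  also have "\<dots> = real (k * ((n - 1) choose k))"
    using real_binomial_pred[of k n] assms(4,5) by (simp add: algebra_simps)
  \<comment> \<open>The value just computed is the upper bound of \<open>cohesion_le\<close> for
    every competitor \<open>Y\<close>, which gives maximality.\<close>
  finally show ?thesis
    using cohesion_le[OF _ _ assms(3) q assms(4)] assms(1) by metis
qed

end
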